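(* There is a universal constant $K$ such that for every finite set $X$ and every increasing family $\mathcal{F}\subseteq 2^X$ (with $\mathcal{F}\neq\emptyset, 2^X$, so that the threshold is defined), \[ p_c(\mathcal{F}) \le K\, q_f(\mathcal{F})\, \log \ell(\mathcal{F}). \]
   Context: $X$ is a finite set and $2^X$ is its power set. A family $\mathcal{F}\subseteq 2^X$ is increasing if $B\supseteq A\in\mathcal{F}$ (with $B\subseteq X$) implies $B\in\mathcal{F}$. For $p\in[0,1]$, $\mu_p$ is the product measure on $2^X$ given by $\mu_p(S)=p^{|S|}(1-p)^{|X\setminus S|}$, and $\mu_p(\mathcal{F})=\sum_{S\in\mathcal{F}}\mu_p(S)$. For increasing $\mathcal{F}\ne\emptyset,2^X$, $\mu_p(\mathcal{F})$ is strictly increasing in $p$, and the threshold $p_c(\mathcal{F})$ is the unique $p$ with $\mu_p(\mathcal{F})=1/2$. $\mathcal{F}$ is weakly $p$-small if there is a function $g:2^X\to[0,\infty)$ such that $\sum_{S\subseteq T}g(S)\ge 1$ for all $T\in\mathcal{F}$ and $\sum_{S\subseteq X}g(S)p^{|S|}\le 1/2$. The fractional expectation-threshold is $q_f(\mathcal{F})=\max\{p: \mathcal{F}\text{ is weakly }p\text{-small}\}$. $\ell(\mathcal{F})$ is the maximum size of a minimal (under inclusion) member of $\mathcal{F}$. $\log$ is the logarithm (changing its base only changes $K$).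
   Formalization: The factor log ℓ(F) is replaced by log max(2, ℓ(F)), since for ℓ(F)=1 the stated bound fails (X={x}, F={X}: p_c=1/2 but log 1=0); X ranges over finite sets of natural numbers, to which every finite set is isomorphic by relabelling. *)

theory Defs
  imports Complex_Main
begin

definition increasing :: "'a set \<Rightarrow> 'a set set \<Rightarrow> bool" where
  "increasing X F \<longleftrightarrow> F \<subseteq> Pow X \<and> (\<forall>A B. A \<in> F \<and> A \<subseteq> B \<and> B \<subseteq> X \<longrightarrow> B \<in> F)"

definition mu :: "'a set \<Rightarrow> real \<Rightarrow> 'a set set \<Rightarrow> real" where
  "mu X p F = (\<Sum>S\<in>F. p ^ card S * (1 - p) ^ card (X - S))"

definition threshold :: "'a set \<Rightarrow> 'a set set \<Rightarrow> real" where
  "threshold X F = (THE p. 0 \<le> p \<and> p \<le> 1 \<and> mu X p F = 1 / 2)"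

definition weakly_small :: "'a set \<Rightarrow> 'a set set \<Rightarrow> real \<Rightarrow> bool" where
  "weakly_small X F p \<longleftrightarrow>
     (\<exists>g :: 'a set \<Rightarrow> real.
        (\<forall>S\<in>Pow X. 0 \<le> g S) \<and>
        (\<forall>T\<in>F. 1 \<le> (\<Sum>S\<in>Pow T. g S)) \<and>
        (\<Sum>S\<in>Pow X. g S * p ^ card S) \<le> 1 / 2)"

(* A maximum over a set of reals that is in general infinite, hence not Max. *)
definition fractional_expectation_threshold :: "'a set \<Rightarrow> 'a set set \<Rightarrow> real" where
  "fractional_expectation_threshold X F =
     (GREATEST p. 0 \<le> p \<and> p \<le> 1 \<and> weakly_small X F p)"

definition minimal_members :: "'a set set \<Rightarrow> 'a set set" where
  "minimal_members F = {A \<in> F. \<forall>B\<in>F. B \<subseteq> A \<longrightarrow> B = A}"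

definition ell :: "'a set set \<Rightarrow> nat" where
  "ell F = Max (card ` minimal_members F)"

(* The bound is stated with ln (max 2 (ell F)). This is ln (ell F) unless ell F = 1, where the
   factor would vanish although the threshold is positive (for X = {x} and F = {X}, the
   threshold is 1/2). *)

(* HOL cannot quantify over types below an existential quantifier, so a constant that is
   universal over all finite sets is stated over finite sets of natural numbers. The lemmas
   below show that nothing is lost: all notions are invariant under relabelling, and a
   constant valid for finite sets of naturals is valid for finite sets over every type. *)

lemma image_subset_iff_inj:
  assumes "inj_on f X" "A \<subseteq> X" "B \<subseteq> X"
  shows "f ` A \<subseteq> f ` B \<longleftrightarrow> A \<subseteq> B"
proof
  assume sub: "f ` A \<subseteq> f ` B"
  show "A \<subseteq> B"
  proof
    fix x assume x: "x \<in> A"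
    then have "f x \<in> f ` B" using sub by (auto simp: image_subset_iff)
    then show "x \<in> B" using inj_on_image_mem_iff[OF assms(1) _ assms(3)] x assms(2) by auto
  qed
qed (rule image_mono)

lemma increasing_image:
  assumes "inj_on f X" "increasing X F"
  shows "increasing (f ` X) ((`) f ` F)"
  unfolding increasing_def
proof (intro conjI allI impI)
  show "(`) f ` F \<subseteq> Pow (f ` X)"
    using assms(2) unfolding increasing_def by blast
next
  fix A B assume AB: "A \<in> (`) f ` F \<and> A \<subseteq> B \<and> B \<subseteq> f ` X"
  then obtain A' where A': "A' \<in> F" "A = f ` A'" by blast
  obtain B' where B': "B' \<subseteq> X" "B = f ` B'" using AB by (meson subset_image_iff)
  have "A' \<subseteq> X" using A' assms(2) unfolding increasing_def by blast
  then have "A' \<subseteq> B'"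
    using AB A' B' image_subset_iff_inj[OF assms(1)] by simp
  then have "B' \<in> F"
    using A' B' assms(2) unfolding increasing_def by meson
  then show "B \<in> (`) f ` F" using B' by simp
qed

lemma mu_image:
  assumes "inj_on f X" "F \<subseteq> Pow X"
  shows "mu (f ` X) p ((`) f ` F) = mu X p F"
proof -
  have inj: "inj_on ((`) f) F"
    using assms by (meson inj_on_image_Pow inj_on_subset)
  have "card (f ` S) = card S \<and> card (f ` X - f ` S) = card (X - S)" if "S \<in> F" for S
  proof -
    have S: "S \<subseteq> X" using that assms(2) by blast
    have "f ` X - f ` S = f ` (X - S)"
      using inj_on_image_set_diff[OF assms(1) _ S, of X] by simp
    then show ?thesis
      using S assms(1) by (metis Diff_subset card_image inj_on_subset)
  qed
  then show ?thesis
    unfolding mu_def sum.reindex[OF inj] by (intro sum.cong) auto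
qed

lemma weakly_small_image:
  assumes "inj_on f X" "F \<subseteq> Pow X"
  shows "weakly_small (f ` X) ((`) f ` F) p \<longleftrightarrow> weakly_small X F p"
proof -
  have inj: "inj_on ((`) f) (Pow T)" if "T \<subseteq> X" for T
    using assms(1) that by (meson inj_on_image_Pow inj_on_subset)
  have sum_Pow: "(\<Sum>S\<in>Pow (f ` T). h S) = (\<Sum>S\<in>Pow T. h (f ` S))"
    if "T \<subseteq> X" for T and h :: "'b set \<Rightarrow> real"
    using sum.reindex[OF inj[OF that], of h] by (simp add: image_Pow_surj)
  have card: "card (f ` S) = card S" if "S \<subseteq> X" for S
    using assms(1) that by (meson card_image inj_on_subset)
  have wsum: "(\<Sum>S\<in>Pow (f ` X). h S * p ^ card S) = (\<Sum>S\<in>Pow X. h (f ` S) * p ^ card S)"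
    for h :: "'b set \<Rightarrow> real"
    unfolding sum_Pow[OF subset_refl] by (rule sum.cong) (auto simp: card)
  show ?thesis
  proof
    assume "weakly_small (f ` X) ((`) f ` F) p"
    then obtain g where g: "\<forall>S\<in>Pow (f ` X). 0 \<le> g S"
      "\<forall>T\<in>(`) f ` F. 1 \<le> (\<Sum>S\<in>Pow T. g S)"
      "(\<Sum>S\<in>Pow (f ` X). g S * p ^ card S) \<le> 1 / 2"
      unfolding weakly_small_def by blast
    have "1 \<le> (\<Sum>S\<in>Pow T. g (f ` S))" if "T \<in> F" for T
    proof -
      have "T \<subseteq> X" using that assms(2) by blast
      then have "(\<Sum>S\<in>Pow T. g (f ` S)) = (\<Sum>S\<in>Pow (f ` T). g S)"
        by (rule sum_Pow[symmetric])
      moreover have "1 \<le> (\<Sum>S\<in>Pow (f ` T). g S)" using g(2) that by simp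
      ultimately show ?thesis by linarith
    qed
    then show "weakly_small X F p"
      unfolding weakly_small_def using g(1) g(3)[unfolded wsum]
      by (intro exI[of _ "\<lambda>S. g (f ` S)"]) auto
  next
    assume "weakly_small X F p"
    then obtain g where g: "\<forall>S\<in>Pow X. 0 \<le> g S" "\<forall>T\<in>F. 1 \<le> (\<Sum>S\<in>Pow T. g S)"
      "(\<Sum>S\<in>Pow X. g S * p ^ card S) \<le> 1 / 2"
      unfolding weakly_small_def by blast
    define h where "h S = g (inv_into X f ` S)" for S
    have h: "h (f ` S) = g S" if "S \<subseteq> X" for S
      unfolding h_def using inv_into_image_cancel[OF assms(1) that] by simp
    have "(\<Sum>S\<in>Pow T. h (f ` S)) = (\<Sum>S\<in>Pow T. g S)" if "T \<subseteq> X" for T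
      using that h by (intro sum.cong) auto
    then have 2: "1 \<le> (\<Sum>S\<in>Pow T. h S)" if "T \<in> (`) f ` F" for T
      using that g(2) assms(2) sum_Pow[of _ h] by auto
    have 1: "0 \<le> h S" if "S \<in> Pow (f ` X)" for S
      using that g(1) h by (auto simp: subset_image_iff)
    have 3: "(\<Sum>S\<in>Pow (f ` X). h S * p ^ card S) \<le> 1 / 2"
      unfolding wsum using g(3) h by simp
    show "weakly_small (f ` X) ((`) f ` F) p"
      unfolding weakly_small_def using 1 2 3 by blast
  qed
qed

lemma ell_image:
  assumes "inj_on f X" "F \<subseteq> Pow X"
  shows "ell ((`) f ` F) = ell F"
proof -
  have sub: "f ` A \<subseteq> f ` B \<longleftrightarrow> A \<subseteq> B" if "A \<in> F" "B \<in> F" for A B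
  proof -
    have "A \<subseteq> X" "B \<subseteq> X" using that assms(2) by blast+
    then show ?thesis by (rule image_subset_iff_inj[OF assms(1)])
  qed
  have "minimal_members ((`) f ` F) = (`) f ` minimal_members F"
  proof -
    have eq: "f ` A = f ` B \<longleftrightarrow> A = B" if "A \<in> F" "B \<in> F" for A B
      using sub[OF that] sub[OF that(2) that(1)] by (metis subset_antisym subset_refl)
    have min: "(\<forall>B\<in>(`) f ` F. B \<subseteq> f ` A \<longrightarrow> B = f ` A) \<longleftrightarrow> (\<forall>B\<in>F. B \<subseteq> A \<longrightarrow> B = A)"
      if "A \<in> F" for A
      unfolding ball_simps using sub eq that by meson
    show ?thesis
      unfolding minimal_members_def Compr_image_eq
      by (rule arg_cong[of _ _ "image (image f)"], intro Collect_cong conj_cong refl, rule min)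
  qed
  moreover have "card (f ` S) = card S" if "S \<in> minimal_members F" for S
  proof -
    have "S \<subseteq> X" using that assms(2) unfolding minimal_members_def by blast
    then show ?thesis using assms(1) by (meson card_image inj_on_subset)
  qed
  ultimately have "card ` minimal_members ((`) f ` F) = card ` minimal_members F"
    by (simp add: image_image)
  then show ?thesis unfolding ell_def by simp
qed

lemma nat_constant_is_universal:
  fixes X :: "'a set"
  assumes nat: "\<And>(Y :: nat set) G. finite Y \<Longrightarrow> increasing Y G \<Longrightarrow> G \<noteq> {} \<Longrightarrow> G \<noteq> Pow Y \<Longrightarrow>
      threshold Y G \<le> K * fractional_expectation_threshold Y G * ln (max 2 (real (ell G)))"
    and X: "finite X" "increasing X F" "F \<noteq> {}" "F \<noteq> Pow X"
  shows "threshold X F \<le> K * fractional_expectation_threshold X F * ln (max 2 (real (ell F)))"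
proof -
  obtain f :: "'a \<Rightarrow> nat" where f: "inj_on f X"
    using finite_imp_inj_to_nat_seg[OF X(1)] by blast
  have F: "F \<subseteq> Pow X" using X(2) unfolding increasing_def by blast
  have "(`) f ` F \<noteq> Pow (f ` X)"
    using F X(4) f inj_on_image_eq_iff[OF inj_on_image_Pow[OF f] F subset_refl]
    by (simp add: image_Pow_surj)
  then have "threshold (f ` X) ((`) f ` F) \<le>
      K * fractional_expectation_threshold (f ` X) ((`) f ` F) * ln (max 2 (real (ell ((`) f ` F))))"
    using nat[of "f ` X" "(`) f ` F"] X increasing_image[OF f X(2)] by simp
  then show ?thesis
    unfolding threshold_def fractional_expectation_threshold_def
    by (simp only: mu_image[OF f F] weakly_small_image[OF f F] ell_image[OF f F])
qed

end

theory Submission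
  imports Defs "HOL-Analysis.Function_Topology"
begin

text \<open>
  The proof follows the argument of Park and Pham for the Kahn--Kalai conjecture, with random sets
  in which every element is included independently. Call the weight \<open>cost p U\<close> of a family \<open>U\<close>
  the sum of \<open>p ^ card T\<close> over its members, and say that \<open>U\<close> covers a family \<open>H\<close> if every member
  of \<open>H\<close> contains a member of \<open>U\<close>. The indicator function of a cover is an admissible weight
  function \<open>g\<close>, so if \<open>F\<close> is not weakly \<open>p\<close>-small, every cover of \<open>F\<close> costs more than \<open>1 / 2\<close>.
  It remains to see that a random set fails to contain a member of \<open>H\<close>, the family of minimal
  members of \<open>F\<close>, with probability at most \<open>1 / 2\<close> when its density is of order \<open>p\<close> times the
  logarithm of the largest size in \<open>H\<close>.

  Reveal a random set \<open>W\<close> of density \<open>q = 16 * p\<close>. What is still missing from the members of \<open>H\<close>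
  are the sets \<open>S - W\<close>; the inclusion-minimal ones among them are the fragments. They cover \<open>H\<close>,
  and a random set that contains a fragment contains, together with \<open>W\<close>, a member of \<open>H\<close>. If all
  sizes in \<open>H\<close> are below \<open>2 * N\<close>, split the fragments into the small ones, of size below \<open>N\<close>, and
  the large ones. The large ones are cheap on average (\<open>expect_cost_large_fragments\<close>): given the set
  \<open>Z = W \<union> T\<close>, a fragment \<open>T\<close> must be a subset of every member of \<open>H\<close> inside \<open>Z\<close>, so there are
  at most \<open>2 ^ (2 * N - 1)\<close> choices for \<open>T\<close>, whereas passing from \<open>W\<close> to \<open>Z\<close> gains a factor
  \<open>(p / q) ^ card T\<close>, at most \<open>(1 / 16) ^ N\<close>. The small ones form a family with half the size bound, to
  which the same step applies with a fresh random set.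

  Since covers of the small fragments become covers of \<open>H\<close> by adding the large ones, these steps
  bound the product of the least cost of a cover with the probability of failure by a convergent
  series (\<open>cover_cost_times_failure\<close>). With about \<open>log 2 l\<close> steps for sets of size at most \<open>l\<close>, the
  union of the revealed sets has density at most \<open>16 * p\<close> times the number of steps. This bounds the
  threshold for every \<open>p\<close> above the fractional expectation-threshold, and \<open>p\<close> can tend to that value
  from the right.
\<close>

section \<open>Expectations over random subsets\<close>

definition expect :: "'a set \<Rightarrow> real \<Rightarrow> ('a set \<Rightarrow> real) \<Rightarrow> real" where
  "expect X p f = (\<Sum>S\<in>Pow X. p ^ card S * (1 - p) ^ card (X - S) * f S)"

lemma expect_empty [simp]: "expect {} p f = f {}"
  by (simp add: expect_def)

text \<open>
  Conditioning on whether \<open>x\<close> is included. This recursion reduces the identities for the product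
  measure to inductions over the ground set.
\<close>

lemma expect_insert:
  assumes "finite X" "x \<notin> X"
  shows "expect (insert x X) p f = (1 - p) * expect X p f + p * expect X p (\<lambda>S. f (insert x S))"
proof -
  let ?m = "\<lambda>S. p ^ card S * (1 - p) ^ card (insert x X - S) * f S"
  have inj: "inj_on (insert x) (Pow X)"
    using assms(2) by (intro inj_onI) (metis PowD insert_ident subsetD)
  have without: "?m S = (1 - p) * (p ^ card S * (1 - p) ^ card (X - S) * f S)" if "S \<in> Pow X" for S
  proof -
    have "insert x X - S = insert x (X - S)" using that assms(2) by auto
    then show ?thesis using assms by simp
  qed
  have "with": "?m (insert x S) = p * (p ^ card S * (1 - p) ^ card (X - S) * f (insert x S))"
    if "S \<in> Pow X" for S
  proof -
    have "insert x X - insert x S = X - S" "x \<notin> S" "finite S"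
      using that assms by (auto intro: finite_subset)
    then show ?thesis by simp
  qed
  have "expect (insert x X) p f = sum ?m (Pow X) + sum ?m (insert x ` Pow X)"
    unfolding expect_def Pow_insert using assms by (intro sum.union_disjoint) auto
  also have "sum ?m (Pow X) = (1 - p) * expect X p f"
    unfolding expect_def sum_distrib_left using without by (rule sum.cong[OF refl])
  also have "sum ?m (insert x ` Pow X) = p * expect X p (\<lambda>S. f (insert x S))"
    unfolding sum.reindex[OF inj] expect_def sum_distrib_left o_def
    using "with" by (rule sum.cong[OF refl])
  finally show ?thesis .
qed

lemma expect_add: "expect X p (\<lambda>S. f S + g S) = expect X p f + expect X p g"
  by (simp add: expect_def algebra_simps sum.distrib)

lemma expect_scale: "expect X p (\<lambda>S. c * f S) = c * expect X p f"
  by (simp add: expect_def algebra_simps sum_distrib_left)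

lemma expect_const:
  assumes "finite X"
  shows "expect X p (\<lambda>S. c) = c"
  using assms by (induction X) (simp_all add: expect_insert algebra_simps)

lemma expect_mono:
  assumes "0 \<le> p" "p \<le> 1" "\<And>S. S \<subseteq> X \<Longrightarrow> f S \<le> g S"
  shows "expect X p f \<le> expect X p g"
  unfolding expect_def using assms by (intro sum_mono mult_left_mono) auto

lemma expect_of_bool_not:
  assumes "finite X"
  shows "expect X p (\<lambda>S. of_bool (\<not> P S)) = 1 - expect X p (\<lambda>S. of_bool (P S))"
proof -
  have "(\<lambda>S. of_bool (P S) + of_bool (\<not> P S)) = (\<lambda>S. 1 :: real)"
    by (auto simp: fun_eq_iff)
  then have "1 = expect X p (\<lambda>S. of_bool (P S) + of_bool (\<not> P S))"
    by (simp only: expect_const[OF assms])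
  then show ?thesis by (simp add: expect_add)
qed

lemma mu_eq_expect:
  assumes "finite X" "F \<subseteq> Pow X"
  shows "mu X p F = expect X p (\<lambda>S. of_bool (S \<in> F))"
  unfolding mu_def expect_def using assms
  by (intro sum.mono_neutral_cong_left) auto

text \<open>
  The union of two independent random sets of densities \<open>p\<close> and \<open>r\<close> is a random set of density
  \<open>1 - (1 - p) * (1 - r)\<close>: an element is left out iff both sets leave it out.
\<close>

lemma expect_union:
  assumes "finite X"
  shows "expect X (p + r - p * r) f = expect X p (\<lambda>S. expect X r (\<lambda>T. f (S \<union> T)))"
  using assms
proof (induction X arbitrary: f)
  case (insert x X)
  let ?e = "\<lambda>f. expect X p (\<lambda>S. expect X r (\<lambda>T. f (S \<union> T)))"
  have "expect (insert x X) p (\<lambda>S. expect (insert x X) r (\<lambda>T. f (S \<union> T)))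
      = (1 - p) * ((1 - r) * ?e f + r * ?e (\<lambda>S. f (insert x S)))
        + p * ((1 - r) * ?e (\<lambda>S. f (insert x S)) + r * ?e (\<lambda>S. f (insert x S)))"
    using insert.hyps by (simp add: expect_insert expect_add expect_scale)
      (simp add: algebra_simps)
  also have "\<dots> = expect (insert x X) (p + r - p * r) f"
    using insert by (simp add: expect_insert algebra_simps)
  finally show ?case ..
qed simp

section \<open>The threshold\<close>

lemma mu_0:
  assumes "finite X" "F \<subseteq> Pow X" "{} \<notin> F"
  shows "mu X 0 F = 0"
  unfolding mu_def using assms by (intro sum.neutral) (auto simp: power_0_left card_eq_0_iff dest: finite_subset)

lemma mu_1:
  assumes "finite X" "F \<subseteq> Pow X" "X \<in> F"
  shows "mu X 1 F = 1"
proof -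
  have fin: "finite F" using assms finite_subset by blast
  have "mu X 1 F = (\<Sum>S\<in>F. if S = X then 1 else 0)"
    unfolding mu_def using assms(1,2) by (intro sum.cong) (auto simp: power_0_left)
  then show ?thesis using assms(3) fin by simp
qed

text \<open>
  A random set of density \<open>p'\<close> arises from one of density \<open>p\<close> by adding an independent random set
  \<open>T\<close>. This keeps members of an increasing family in the family, and the event that \<open>S\<close> is empty
  and \<open>T\<close> is everything, of positive probability, makes the gain strict.
\<close>

lemma mu_strict_mono:
  assumes "finite X" "increasing X F" "{} \<notin> F" "X \<in> F" "0 \<le> p" "p < p'" "p' \<le> 1"
  shows "mu X p F < mu X p' F"
proof -
  have F: "F \<subseteq> Pow X" using assms(2) by (simp add: increasing_def)
  \<comment> \<open>The solution of \<open>1 - p' = (1 - p) * (1 - r)\<close>.\<close>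
  define r where "r = (p' - p) / (1 - p)"
  have r: "0 < r" "r \<le> 1"
    using assms by (auto simp: r_def)
  have "r * (1 - p) = p' - p"
    using assms by (simp add: r_def)
  then have p': "p' = p + r - p * r"
    by (simp add: algebra_simps)
  let ?in = "\<lambda>S. of_bool (S \<in> F) :: real"
  let ?gain = "\<lambda>S T. of_bool (S = {}) * of_bool (T = X) :: real"
  have point: "expect X t (\<lambda>S. of_bool (S = A)) = t ^ card A * (1 - t) ^ card (X - A)"
    if "A \<subseteq> X" for t A
  proof -
    have "expect X t (\<lambda>S. of_bool (S = A))
        = (\<Sum>S\<in>Pow X. if S = A then t ^ card A * (1 - t) ^ card (X - A) else 0)"
      unfolding expect_def by (intro sum.cong) auto
    then show ?thesis using that assms(1) by simp
  qed
  have "mu X p F < mu X p F + (1 - p) ^ card X * r ^ card X"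
    using assms r by simp
  also have "\<dots> = expect X p (\<lambda>S. expect X r (\<lambda>T. ?in S + ?gain S T))"
  proof -
    have "expect X p (\<lambda>S. expect X r (\<lambda>T. ?gain S T)) = r ^ card X * (1 - p) ^ card X"
      using point[of X r] point[of "{}" p]
      by (simp add: expect_scale mult.commute)
    then show ?thesis
      by (simp add: expect_add expect_const assms(1) mu_eq_expect[OF assms(1) F])
  qed
  also have "\<dots> \<le> expect X p (\<lambda>S. expect X r (\<lambda>T. ?in (S \<union> T)))"
  proof (intro expect_mono)
    fix S T assume ST: "S \<subseteq> X" "T \<subseteq> X"
    have "S \<union> T \<in> F" if "S \<in> F"
    proof -
      have "S \<subseteq> S \<union> T" "S \<union> T \<subseteq> X" using ST by auto
      then show ?thesis using that assms(2) unfolding increasing_def by meson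
    qed
    then show "?in S + ?gain S T \<le> ?in (S \<union> T)"
      using assms(3,4) by (cases "S \<in> F"; cases "S = {}"; cases "T = X") simp_all
  next
    show "0 \<le> p" by (rule assms(5))
    show "p \<le> 1" using assms(6,7) by simp
    show "0 \<le> r" "r \<le> 1" using r by simp_all
  qed
  also have "\<dots> = mu X p' F"
    unfolding mu_eq_expect[OF assms(1) F] p' by (rule expect_union[OF assms(1), symmetric])
  finally show ?thesis .
qed

text \<open>
  The value \<open>1 / 2\<close> is taken in \<open>{0..s}\<close> by continuity, and strict monotonicity identifies the
  place with the threshold.
\<close>

lemma threshold_le:
  assumes "finite X" "increasing X F" "{} \<notin> F" "X \<in> F" "0 \<le> s" "s \<le> 1" "1 / 2 \<le> mu X s F"
  shows "threshold X F \<le> s"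
proof -
  have F: "F \<subseteq> Pow X" using assms(2) by (simp add: increasing_def)
  have "continuous_on {0..s} (\<lambda>p. mu X p F)"
    unfolding mu_def by (intro continuous_intros)
  then obtain c where c: "0 \<le> c" "c \<le> s" "mu X c F = 1 / 2"
    using IVT'[of "\<lambda>p. mu X p F" 0 "1 / 2" s] mu_0[OF assms(1) F assms(3)] assms(5,7) by auto
  have "threshold X F = c"
    unfolding threshold_def
  proof (rule the_equality)
    fix p assume p: "0 \<le> p \<and> p \<le> 1 \<and> mu X p F = 1 / 2"
    then show "p = c"
      using mu_strict_mono[OF assms(1-4), of p c] mu_strict_mono[OF assms(1-4), of c p] c assms(6)
      by (cases p c rule: linorder_cases) auto
  qed (use c assms(6) in auto)
  then show ?thesis using c(2) by simp
qed

section \<open>The maximum defining the fractional expectation-threshold\<close>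

lemma not_weakly_small_1:
  assumes "finite X" "F \<subseteq> Pow X" "X \<in> F"
  shows "\<not> weakly_small X F 1"
proof
  assume "weakly_small X F 1"
  then obtain g where g: "\<forall>T\<in>F. (1::real) \<le> (\<Sum>S\<in>Pow T. g S)" "(\<Sum>S\<in>Pow X. g S) \<le> 1 / 2"
    unfolding weakly_small_def by auto
  then have "1 \<le> (\<Sum>S\<in>Pow X. g S)" using assms(3) by blast
  then show False using g(2) by linarith
qed

text \<open>
  Truncating a weight function at \<open>1\<close> does not destroy its feasibility, since a single weight
  \<open>1\<close> below \<open>T\<close> already satisfies the constraint for \<open>T\<close>. Bounded weight functions form a compact
  set, which is what the existence of the maximum rests on.
\<close>

lemma weakly_small_bounded:
  assumes "finite X" "F \<subseteq> Pow X" "0 \<le> p"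
  shows "weakly_small X F p \<longleftrightarrow>
    (\<exists>g. (\<forall>S. 0 \<le> g S \<and> g S \<le> 1) \<and> (\<forall>T\<in>F. 1 \<le> (\<Sum>S\<in>Pow T. g S)) \<and>
       (\<Sum>S\<in>Pow X. g S * p ^ card S) \<le> 1 / 2)"
proof
  assume "weakly_small X F p"
  then obtain g where g: "\<forall>S\<in>Pow X. 0 \<le> g S" "\<forall>T\<in>F. 1 \<le> (\<Sum>S\<in>Pow T. g S)"
      "(\<Sum>S\<in>Pow X. g S * p ^ card S) \<le> 1 / 2"
    unfolding weakly_small_def by blast
  define h where "h S = (if S \<subseteq> X then min 1 (g S) else 0)" for S
  have h: "\<forall>S. 0 \<le> h S \<and> h S \<le> 1" using g(1) by (auto simp: h_def)
  have "1 \<le> (\<Sum>S\<in>Pow T. h S)" if T: "T \<in> F" for T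
  proof -
    have TX: "T \<subseteq> X" "finite T" using T assms finite_subset by blast+
    show ?thesis
    proof (cases "\<exists>S\<in>Pow T. 1 \<le> g S")
      case True
      then obtain S where S: "S \<in> Pow T" "1 \<le> g S" by blast
      then have "h S = 1" using TX by (auto simp: h_def)
      then show ?thesis
        using member_le_sum[OF S(1), of h] h TX by auto
    next
      case False
      then have "(\<Sum>S\<in>Pow T. h S) = (\<Sum>S\<in>Pow T. g S)"
        using TX by (intro sum.cong) (force simp: h_def min_def)+
      then show ?thesis using g(2) T by simp
    qed
  qed
  moreover have "(\<Sum>S\<in>Pow X. h S * p ^ card S) \<le> (\<Sum>S\<in>Pow X. g S * p ^ card S)"
    using assms(3) by (intro sum_mono mult_right_mono) (auto simp: h_def)
  ultimately show "\<exists>g. (\<forall>S. 0 \<le> g S \<and> g S \<le> 1) \<and> (\<forall>T\<in>F. 1 \<le> (\<Sum>S\<in>Pow T. g S)) \<and>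
       (\<Sum>S\<in>Pow X. g S * p ^ card S) \<le> 1 / 2"
    using h g(3) by (intro exI[of _ h]) auto
qed (auto simp: weakly_small_def)

text \<open>Tychonoff's theorem, in the product topology of the function type.\<close>

lemma compact_unit_functions: "compact {g :: 'i \<Rightarrow> real. \<forall>i. 0 \<le> g i \<and> g i \<le> 1}"
proof -
  have "compactin (product_topology (\<lambda>i. euclidean) UNIV) (PiE UNIV (\<lambda>i :: 'i. {0..1 :: real}))"
    by (simp add: compactin_PiE)
  moreover have "PiE UNIV (\<lambda>i :: 'i. {0..1 :: real}) = {g. \<forall>i. 0 \<le> g i \<and> g i \<le> 1}"
    by (auto simp: PiE_def Pi_def)
  ultimately show ?thesis by (simp add: euclidean_product_topology)
qed

text \<open>
  The admissible values \<open>p\<close> are the projection of a closed set of pairs \<open>(p, g)\<close> in a compact box,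
  hence a compact set, which contains \<open>0\<close> because the nonempty sets cover \<open>F\<close>
  and have weight \<open>0 ^ card S = 0\<close>.
\<close>

lemma greatest_weakly_small:
  assumes "finite X" "F \<subseteq> Pow X" "{} \<notin> F"
  obtains m where "0 \<le> m" "m \<le> 1" "weakly_small X F m"
    "\<And>p. 0 \<le> p \<Longrightarrow> p \<le> 1 \<Longrightarrow> weakly_small X F p \<Longrightarrow> p \<le> m"
proof -
  let ?feasible = "\<lambda>z :: real \<times> ('a set \<Rightarrow> real). (\<forall>T\<in>F. 1 \<le> (\<Sum>S\<in>Pow T. snd z S)) \<and>
      (\<Sum>S\<in>Pow X. snd z S * fst z ^ card S) \<le> 1 / 2"
  let ?box = "{0..1 :: real} \<times> {g :: 'a set \<Rightarrow> real. \<forall>S. 0 \<le> g S \<and> g S \<le> 1}"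
  define P where "P = {p. 0 \<le> p \<and> p \<le> 1 \<and> weakly_small X F p}"
  have coord: "continuous_on UNIV (\<lambda>z :: real \<times> ('a set \<Rightarrow> real). snd z S)" for S
    by (rule continuous_on_compose2[OF continuous_on_product_coordinates])
      (auto intro: continuous_intros)
  have "closed {z. ?feasible z}"
    unfolding Ball_def
    by (intro closed_Collect_conj closed_Collect_all closed_Collect_imp open_Collect_const
        closed_Collect_le continuous_intros coord)
  then have "compact (?box \<inter> {z. ?feasible z})"
    by (intro compact_Int_closed compact_Times compact_unit_functions) auto
  then have "compact (fst ` (?box \<inter> {z. ?feasible z}))"
    by (intro compact_continuous_image continuous_intros)
  moreover have "fst ` (?box \<inter> {z. ?feasible z}) = P"
  proof (intro equalityI subsetI)
    fix p assume "p \<in> fst ` (?box \<inter> {z. ?feasible z})"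
    then obtain g where "(p, g) \<in> ?box" "?feasible (p, g)" by (elim imageE) auto
    then show "p \<in> P"
      using weakly_small_bounded[OF assms(1,2), of p] by (auto simp: P_def)
  next
    fix p assume "p \<in> P"
    then obtain g where "(p, g) \<in> ?box" "?feasible (p, g)"
      using weakly_small_bounded[OF assms(1,2), of p] by (auto simp: P_def)
    then show "p \<in> fst ` (?box \<inter> {z. ?feasible z})"
      by (intro image_eqI[of _ _ "(p, g)"]) simp_all
  qed
  ultimately have "compact P" by simp
  moreover have "0 \<in> P"
  proof -
    have "weakly_small X F 0"
      unfolding weakly_small_def
    proof (intro exI[of _ "\<lambda>S. of_bool (S \<noteq> {})"] conjI ballI)
      fix T assume T: "T \<in> F"
      then have fT: "finite T" "T \<noteq> {}" using assms finite_subset by blast+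
      then show "1 \<le> (\<Sum>S\<in>Pow T. of_bool (S \<noteq> {}) :: real)"
        using member_le_sum[of T "Pow T" "\<lambda>S. of_bool (S \<noteq> {}) :: real"] by auto
    next
      have "(\<Sum>S\<in>Pow X. of_bool (S \<noteq> {}) * 0 ^ card S) = (0 :: real)"
        using assms(1) by (intro sum.neutral) (auto simp: power_0_left card_eq_0_iff dest: finite_subset)
      then show "(\<Sum>S\<in>Pow X. of_bool (S \<noteq> {}) * 0 ^ card S) \<le> (1 / 2 :: real)" by simp
    qed auto
    then show ?thesis by (simp add: P_def)
  qed
  ultimately obtain m where "m \<in> P" "\<forall>p\<in>P. p \<le> m"
    using compact_attains_sup[of P] by blast
  then show ?thesis using that by (auto simp: P_def)
qed

section \<open>Covers and their costs\<close>

definition covers :: "'a set set \<Rightarrow> 'a set set \<Rightarrow> bool" where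
  "covers U H \<longleftrightarrow> (\<forall>S\<in>H. \<exists>T\<in>U. T \<subseteq> S)"

definition cost :: "real \<Rightarrow> 'a set set \<Rightarrow> real" where
  "cost p U = (\<Sum>T\<in>U. p ^ card T)"

text \<open>The indicator function of a cover of cost at most \<open>1 / 2\<close> would witness weak smallness.\<close>

lemma not_weakly_small_cost:
  assumes "finite X" "F \<subseteq> Pow X" "\<not> weakly_small X F p" "U \<subseteq> Pow X" "covers U F"
  shows "1 / 2 < cost p U"
proof (rule ccontr)
  assume "\<not> 1 / 2 < cost p U"
  moreover have "(\<Sum>S\<in>Pow X. of_bool (S \<in> U) * p ^ card S) = cost p U"
    unfolding cost_def using assms(1,4) by (intro sum.mono_neutral_cong_right) auto
  moreover have "1 \<le> (\<Sum>S\<in>Pow T. of_bool (S \<in> U) :: real)" if T: "T \<in> F" for T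
  proof -
    obtain S where S: "S \<in> U" "S \<in> Pow T" using assms(5) T unfolding covers_def by blast
    have "finite T" using T assms(1,2) finite_subset by blast
    then show ?thesis
      using member_le_sum[OF S(2), of "\<lambda>S. of_bool (S \<in> U) :: real"] S(1) by auto
  qed
  ultimately have "weakly_small X F p"
    unfolding weakly_small_def by (intro exI[of _ "\<lambda>S. of_bool (S \<in> U)"]) auto
  then show False using assms(3) by contradiction
qed

lemma minimal_member_below:
  assumes "finite A" "A \<in> F"
  obtains B where "B \<in> minimal_members F" "B \<subseteq> A"
proof -
  have "\<exists>B\<in>minimal_members F. B \<subseteq> A" using assms
  proof (induction A rule: finite_psubset_induct)
    case (psubset A)
    show ?case
    proof (cases "A \<in> minimal_members F")
      case False
      then obtain B where "B \<in> F" "B \<subset> A"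
        using psubset.prems unfolding minimal_members_def by blast
      then show ?thesis using psubset.IH[of B] by blast
    qed auto
  qed
  then show ?thesis using that by blast
qed

section \<open>Fragments\<close>

text \<open>
  The fragments are what remains to be found of the members of \<open>H\<close> after \<open>W\<close> is revealed, reduced to
  the inclusion-minimal remainders.
\<close>

definition fragments :: "'a set set \<Rightarrow> 'a set \<Rightarrow> 'a set set" where
  "fragments H W = minimal_members ((\<lambda>S. S - W) ` H)"

lemma fragments_subset:
  assumes "H \<subseteq> Pow X"
  shows "fragments H W \<subseteq> Pow X"
  using assms unfolding fragments_def minimal_members_def by auto

lemma fragments_cover:
  assumes "finite S" "S \<in> H"
  obtains T where "T \<in> fragments H W" "T \<subseteq> S"
proof -
  have "finite (S - W)" "S - W \<in> (\<lambda>S. S - W) ` H" using assms by auto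
  then obtain T where "T \<in> fragments H W" "T \<subseteq> S - W"
    unfolding fragments_def by (rule minimal_member_below)
  then show ?thesis using that by blast
qed

lemma fragment_completes:
  assumes "T \<in> fragments H W"
  obtains S where "S \<in> H" "T = S - W"
  using assms unfolding fragments_def minimal_members_def by blast

text \<open>
  Minimality at work: the remainder of \<open>S\<close> lies inside \<open>T\<close>, so it cannot be smaller than \<open>T\<close>. The
  point is that \<open>S\<close> can be chosen from the union \<open>W \<union> T\<close> alone, which confines the unknown
  fragment \<open>T\<close> to the subsets of a known small set.
\<close>

lemma fragment_subset_edge:
  assumes "T \<in> fragments H W" "S \<in> H" "S \<subseteq> W \<union> T"
  shows "T \<subseteq> S"
proof -
  have "S - W \<in> (\<lambda>S. S - W) ` H" "S - W \<subseteq> T" using assms by auto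
  then have "S - W = T"
    using assms(1) unfolding fragments_def minimal_members_def by blast
  then show ?thesis by blast
qed

text \<open>
  Sum over pairs \<open>(W, T)\<close> with \<open>T\<close> a large fragment, and reindex by \<open>(W \<union> T, T)\<close>. As \<open>p = q / 16\<close>
  for the density \<open>q\<close> of \<open>W\<close>, the weight of \<open>(W, T)\<close> is at most \<open>(1 / 16) ^ card T\<close> times the
  probability of \<open>W \<union> T\<close>. For each value of the union at most \<open>2 ^ (2 * N - 1)\<close> fragments \<open>T\<close>
  occur, by \<open>fragment_subset_edge\<close>.
\<close>

lemma expect_cost_large_fragments:
  assumes "finite X" "H \<subseteq> Pow X" "0 < N" "\<forall>S\<in>H. card S < 2 * N" "0 \<le> p" "16 * p \<le> 1"
  shows "expect X (16 * p) (\<lambda>W. cost p {T \<in> fragments H W. N \<le> card T}) \<le> (1 / 4) ^ N / 2"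
proof -
  define q where "q = 16 * p"
  have q: "0 \<le> q" "q \<le> 1" using assms(5,6) by (auto simp: q_def)
  let ?L = "\<lambda>W. {T \<in> fragments H W. N \<le> card T}"
  let ?m = "\<lambda>W. q ^ card W * (1 - q) ^ card (X - W)"
  \<comment> \<open>A reference member of \<open>H\<close> inside \<open>Z\<close>; where none exists, no pair has union \<open>Z\<close>, and the empty
    set keeps the bound on the size true.\<close>
  define R where "R Z = (if \<exists>S\<in>H. S \<subseteq> Z then SOME S. S \<in> H \<and> S \<subseteq> Z else {})" for Z
  have R: "R Z \<in> H \<and> R Z \<subseteq> Z" if "\<exists>S\<in>H. S \<subseteq> Z" for Z
    using that someI_ex[of "\<lambda>S. S \<in> H \<and> S \<subseteq> Z"] by (auto simp: R_def)
  have finL: "finite (?L W)" for W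
    using fragments_subset[OF assms(2), of W] assms(1) by (auto intro: finite_subset)
  have finR: "finite (R Z)" for Z
    using R[of Z] assms(1,2) by (cases "\<exists>S\<in>H. S \<subseteq> Z") (auto simp: R_def intro: finite_subset)
  let ?A = "Sigma (Pow X) ?L"
  let ?B = "Sigma (Pow X) (\<lambda>Z. Pow (R Z))"
  let ?\<phi> = "\<lambda>(W, T). (W \<union> T, T)"
  let ?c = "(1 / 16 :: real) ^ N"
  have pair: "T \<subseteq> X \<and> W \<inter> T = {} \<and> T \<subseteq> R (W \<union> T) \<and> N \<le> card T"
    if "(W, T) \<in> ?A" for W T
  proof -
    have T: "T \<in> fragments H W" "N \<le> card T" using that by auto
    obtain S where S: "S \<in> H" "T = S - W" using T(1) by (rule fragment_completes)
    then have "\<exists>S\<in>H. S \<subseteq> W \<union> T" by blast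
    then have "R (W \<union> T) \<in> H" "R (W \<union> T) \<subseteq> W \<union> T" using R by blast+
    then have "T \<subseteq> R (W \<union> T)" using fragment_subset_edge[OF T(1)] by blast
    then show ?thesis using S assms(2) T(2) by auto
  qed
  have inj: "inj_on ?\<phi> ?A"
  proof (rule inj_onI)
    fix x y assume xy: "x \<in> ?A" "y \<in> ?A" "?\<phi> x = ?\<phi> y"
    obtain W T W' where eq: "x = (W, T)" "y = (W', T)" "W \<union> T = W' \<union> T"
      using xy(3) by (cases x; cases y) auto
    then have "W \<inter> T = {}" "W' \<inter> T = {}" using pair xy(1,2) by blast+
    then have "W = W'" using eq(3) by blast
    then show "x = y" using eq by simp
  qed
  \<comment> \<open>An element of \<open>T\<close> contributes \<open>p * (1 - q)\<close> on the left and \<open>q = 16 * p\<close> to the probability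
    of the union, so each of at least \<open>N\<close> elements gains a factor \<open>1 / 16\<close>.\<close>
  have weight: "?m W * p ^ card T \<le> ?m (W \<union> T) * ?c" if WT: "(W, T) \<in> ?A" for W T
  proof -
    have W: "W \<subseteq> X" using WT by auto
    have T: "T \<subseteq> X" "W \<inter> T = {}" "N \<le> card T" using pair[OF WT] by auto
    have fin: "finite W" "finite T" using W T assms(1) finite_subset by blast+
    have "p ^ card T = q ^ card T * (1 / 16) ^ card T"
      unfolding q_def power_mult_distrib[symmetric] by simp
    then have "?m W * p ^ card T = q ^ card (W \<union> T) * (1 - q) ^ card (X - W) * (1 / 16) ^ card T"
      using fin T(2) by (simp add: card_Un_disjoint power_add)
    also have "\<dots> \<le> q ^ card (W \<union> T) * (1 - q) ^ card (X - (W \<union> T)) * ?c"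
      using q T(3) assms(1)
      by (intro mult_mono mult_left_mono power_decreasing card_mono) auto
    finally show ?thesis .
  qed
  have "expect X q (\<lambda>W. cost p (?L W)) = (\<Sum>W\<in>Pow X. \<Sum>T\<in>?L W. ?m W * p ^ card T)"
    by (simp add: expect_def cost_def sum_distrib_left)
  also have "\<dots> = (\<Sum>(W, T)\<in>?A. ?m W * p ^ card T)"
    using assms(1) finL by (intro sum.Sigma) auto
  also have "\<dots> \<le> (\<Sum>(W, T)\<in>?A. ?m (W \<union> T) * ?c)"
    using weight by (intro sum_mono) (auto simp del: mem_Sigma_iff)
  also have "\<dots> = (\<Sum>(Z, T)\<in>?\<phi> ` ?A. ?m Z * ?c)"
    unfolding sum.reindex[OF inj] by (intro sum.cong) auto
  also have "\<dots> \<le> (\<Sum>(Z, T)\<in>?B. ?m Z * ?c)"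
  proof (rule sum_mono2)
    show "finite ?B" using assms(1) finR by auto
    show "?\<phi> ` ?A \<subseteq> ?B"
    proof (intro image_subsetI)
      fix x assume x: "x \<in> ?A"
      then obtain W T where WT: "x = (W, T)" "W \<subseteq> X" by auto
      then have "T \<subseteq> X" "T \<subseteq> R (W \<union> T)" using pair[of W T] x by blast+
      then show "?\<phi> x \<in> ?B" using WT by simp
    qed
  qed (use q in auto)
  also have "\<dots> = (\<Sum>Z\<in>Pow X. \<Sum>T\<in>Pow (R Z). ?m Z * ?c)"
    using assms(1) finR by (intro sum.Sigma[symmetric]) auto
  also have "\<dots> = expect X q (\<lambda>Z. 2 ^ card (R Z) * ?c)"
    unfolding expect_def using finR by (intro sum.cong) (auto simp: card_Pow)
  also have "\<dots> \<le> expect X q (\<lambda>Z. (1 / 4) ^ N / 2)"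
  proof (rule expect_mono[OF q])
    fix Z
    have "card (R Z) < 2 * N"
      using R[of Z] assms(3,4) by (cases "\<exists>S\<in>H. S \<subseteq> Z") (auto simp: R_def)
    then have "(2 :: real) ^ Suc (card (R Z)) \<le> 2 ^ (2 * N)"
      by (intro power_increasing) auto
    then have "(2 :: real) ^ card (R Z) \<le> 4 ^ N / 2"
      by (simp add: power_mult)
    then have "2 ^ card (R Z) * ?c \<le> 4 ^ N / 2 * ?c"
      by (intro mult_right_mono) auto
    also have "\<dots> = (4 * (1 / 16)) ^ N / 2"
      unfolding power_mult_distrib by simp
    finally show "2 ^ card (R Z) * ?c \<le> (1 / 4) ^ N / 2"
      by simp
  qed
  also have "\<dots> = (1 / 4) ^ N / 2" by (rule expect_const[OF assms(1)])
  finally show ?thesis by (simp add: q_def)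
qed

section \<open>Iterated halving of the sizes\<close>

lemma cost_union_le:
  assumes "finite U" "finite V" "0 \<le> p"
  shows "cost p (U \<union> V) \<le> cost p U + cost p V"
  unfolding cost_def using assms by (simp add: sum_Un sum_nonneg)

text \<open>
  Here \<open>\<theta>\<close> is any lower bound for the costs of covers of \<open>H\<close>, and \<open>k\<close> counts the random sets of
  density \<open>16 * p\<close> that are revealed. After the first of them, \<open>\<theta>\<close> minus the cost of the large
  fragments is a lower bound for the covers of the small fragments, whose sizes are below
  \<open>2 ^ (k - 1)\<close>. So each round loses at most the expected cost of the large fragments. For this
  recursion \<open>\<theta>\<close> must be allowed to become negative. In the end (\<open>k = 0\<close>) either \<open>H\<close> is empty
  and has a cover of cost \<open>0\<close>, or it contains the empty set and failure is impossible.
\<close>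

lemma cover_cost_times_failure:
  assumes "finite X" "0 \<le> p" "16 * p \<le> 1"
  assumes "H \<subseteq> Pow X" "\<forall>S\<in>H. card S < 2 ^ k"
  assumes "\<And>U. U \<subseteq> Pow X \<Longrightarrow> covers U H \<Longrightarrow> \<theta> \<le> cost p U"
  shows "\<theta> * expect X (1 - (1 - 16 * p) ^ k) (\<lambda>W. of_bool (\<not> (\<exists>S\<in>H. S \<subseteq> W)))
    \<le> (1 - (1 / 4) ^ k) / 6"
  using assms(4-6)
proof (induction k arbitrary: H \<theta>)
  case 0
  have sub: "H \<subseteq> {{}}"
  proof
    fix S assume S: "S \<in> H"
    then have "finite S" "card S = 0" using 0 assms(1) by (auto intro: finite_subset)
    then show "S \<in> {{}}" by simp
  qed
  show ?case
  proof (cases "H = {}")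
    case True
    then have "\<theta> \<le> 0" using "0.prems"(3)[of "{}"] by (simp add: covers_def cost_def)
    then show ?thesis using True by (simp add: expect_const[OF assms(1)])
  next
    case False
    then have "H = {{}}" using sub by blast
    then show ?thesis by (simp add: expect_const[OF assms(1), of _ 0])
  qed
next
  case (Suc k)
  define q where "q = 16 * p"
  have q: "0 \<le> q" "q \<le> 1" using assms(2,3) by (auto simp: q_def)
  define s where "s = 1 - (1 - q) ^ k"
  have s: "0 \<le> s" "s \<le> 1" using q by (auto simp: s_def power_le_one)
  let ?fail = "\<lambda>H W. of_bool (\<not> (\<exists>S\<in>H. S \<subseteq> W)) :: real"
  let ?large = "\<lambda>W. {T \<in> fragments H W. 2 ^ k \<le> card T}"
  let ?small = "\<lambda>W. {T \<in> fragments H W. card T < 2 ^ k}"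
  have step: "1 - (1 - q) ^ Suc k = q + s - q * s" by (simp add: s_def algebra_simps)
  have fragX: "fragments H W \<subseteq> Pow X" for W by (rule fragments_subset[OF Suc.prems(1)])
  have fin: "finite U" if "U \<subseteq> Pow X" for U using that assms(1) by (simp add: finite_subset)
  \<comment> \<open>The induction hypothesis for the small fragments, with \<open>W\<close> fixed.\<close>
  have rest: "\<theta> * expect X s (?fail (?small W)) \<le> cost p (?large W) + (1 - (1 / 4) ^ k) / 6" for W
  proof -
    let ?P = "expect X s (?fail (?small W))"
    have P: "?P \<le> 1"
      using expect_mono[OF s, of X "?fail (?small W)" "\<lambda>_. 1"] expect_const[OF assms(1), of s 1]
      by simp
    have lower: "\<theta> - cost p (?large W) \<le> cost p U"
      if U: "U \<subseteq> Pow X" "covers U (?small W)" for U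
    proof -
      have "covers (U \<union> ?large W) H"
        unfolding covers_def
      proof
        fix S assume S: "S \<in> H"
        then have "finite S" using Suc.prems(1) assms(1) finite_subset by blast
        then obtain T where T: "T \<in> fragments H W" "T \<subseteq> S"
          using S by (rule fragments_cover)
        show "\<exists>T\<in>U \<union> ?large W. T \<subseteq> S"
        proof (cases "card T < 2 ^ k")
          case True
          then have "T \<in> ?small W" using T(1) by simp
          then obtain T' where "T' \<in> U" "T' \<subseteq> T" using U(2) unfolding covers_def by meson
          then show ?thesis using T(2) by (intro bexI[of _ T']) auto
        next
          case False
          then show ?thesis using T by (intro bexI[of _ T]) auto
        qed
      qed
      then have "\<theta> \<le> cost p (U \<union> ?large W)"
        using U(1) fragX by (intro Suc.prems(3)) auto
      also have "\<dots> \<le> cost p U + cost p (?large W)"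
        using U(1) fragX assms(2) by (intro cost_union_le fin) auto
      finally show ?thesis by simp
    qed
    have "(\<theta> - cost p (?large W)) * ?P \<le> (1 - (1 / 4) ^ k) / 6"
      unfolding s_def q_def
      by (rule Suc.IH[OF _ _ lower]) (use fragX in auto)
    moreover have "cost p (?large W) * ?P \<le> cost p (?large W)"
      using P assms(2) by (intro mult_left_le) (auto simp: cost_def sum_nonneg)
    ultimately show ?thesis unfolding left_diff_distrib by linarith
  qed
  have "expect X (q + s - q * s) (?fail H) = expect X q (\<lambda>W. expect X s (\<lambda>V. ?fail H (W \<union> V)))"
    by (rule expect_union[OF assms(1)])
  also have "\<dots> \<le> expect X q (\<lambda>W. expect X s (?fail (?small W)))"
  proof (intro expect_mono q s)
    fix W V
    have "\<exists>S\<in>H. S \<subseteq> W \<union> V" if "T \<in> ?small W" "T \<subseteq> V" for T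
    proof -
      have "T \<in> fragments H W" using that by simp
      then obtain S where "S \<in> H" "T = S - W" by (rule fragment_completes)
      then show ?thesis using that(2) by blast
    qed
    then show "?fail H (W \<union> V) \<le> ?fail (?small W) V" by auto
  qed
  finally have fail: "expect X (1 - (1 - 16 * p) ^ Suc k) (?fail H)
      \<le> expect X q (\<lambda>W. expect X s (?fail (?small W)))"
    unfolding q_def[symmetric] step .
  show ?case
  proof (cases "0 \<le> \<theta>")
    case True
    have "\<theta> * expect X (1 - (1 - 16 * p) ^ Suc k) (?fail H)
        \<le> \<theta> * expect X q (\<lambda>W. expect X s (?fail (?small W)))"
      using fail True by (rule mult_left_mono)
    also have "\<dots> = expect X q (\<lambda>W. \<theta> * expect X s (?fail (?small W)))"
      by (rule expect_scale[symmetric])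
    also have "\<dots> \<le> expect X q (\<lambda>W. cost p (?large W) + (1 - (1 / 4) ^ k) / 6)"
      using q rest by (rule expect_mono)
    also have "\<dots> = expect X q (\<lambda>W. cost p (?large W)) + (1 - (1 / 4) ^ k) / 6"
      by (simp add: expect_add expect_const assms(1))
    also have "expect X q (\<lambda>W. cost p (?large W)) \<le> (1 / 4) ^ 2 ^ k / 2"
      unfolding q_def using Suc.prems assms
      by (intro expect_cost_large_fragments) auto
    \<comment> \<open>Crude, but half of the right-hand side is exactly the increment of \<open>(1 - (1 / 4) ^ k) / 6\<close>.\<close>
    also have "(1 / 4 :: real) ^ 2 ^ k \<le> (1 / 4) ^ Suc k"
      by (intro power_decreasing) (auto simp: Suc_leI)
    also have "(1 / 4 :: real) ^ Suc k / 2 + (1 - (1 / 4) ^ k) / 6 = (1 - (1 / 4) ^ Suc k) / 6"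
      unfolding power_Suc by argo
    finally show ?thesis by simp
  next
    case False
    have "0 \<le> expect X (1 - (1 - 16 * p) ^ Suc k) (?fail H)"
      unfolding expect_def using q power_le_one[of "1 - q" "Suc k"]
      by (intro sum_nonneg mult_nonneg_nonneg zero_le_power) (auto simp flip: q_def)
    then have "\<theta> * expect X (1 - (1 - 16 * p) ^ Suc k) (?fail H) \<le> 0"
      using False by (intro mult_nonpos_nonneg) auto
    also have "0 \<le> (1 - (1 / 4 :: real) ^ Suc k) / 6"
      using power_le_one[of "1 / 4 :: real" "Suc k"] by simp
    finally show ?thesis .
  qed
qed

text \<open>
  Covers of the minimal members are covers of \<open>F\<close> and thus cost at least \<open>1 / 2\<close>, so the failure
  probability after \<open>k\<close> rounds is at most \<open>1 / 3\<close>. When \<open>16 * k * p\<close> is at least \<open>1\<close>, where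
  \<open>16 * p\<close> need not be a probability, the bound is trivial.
\<close>

lemma threshold_le_of_not_weakly_small:
  assumes "finite X" "increasing X F" "{} \<notin> F" "X \<in> F"
  assumes "0 \<le> p" "\<not> weakly_small X F p" "ell F < 2 ^ k"
  shows "threshold X F \<le> 16 * real k * p"
proof (cases "16 * real k * p \<ge> 1")
  case True
  have "F \<subseteq> Pow X" using assms(2) by (simp add: increasing_def)
  then have "threshold X F \<le> 1"
    using assms mu_1[of X F] by (intro threshold_le) auto
  then show ?thesis using True by simp
next
  case False
  have F: "F \<subseteq> Pow X" using assms(2) by (simp add: increasing_def)
  define H where "H = minimal_members F"
  have H: "H \<subseteq> F" by (auto simp: H_def minimal_members_def)
  have finH: "finite H" using H F assms(1) by (meson finite_Pow_iff finite_subset)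
  have small: "card S < 2 ^ k" if "S \<in> H" for S
  proof -
    have "card S \<le> ell F"
      unfolding ell_def using finH that by (intro Max_ge) (auto simp: H_def)
    then show ?thesis using assms(7) by simp
  qed
  have below: "\<exists>S\<in>H. S \<subseteq> A" if "A \<in> F" for A
  proof -
    have "finite A" using that F assms(1) finite_subset by blast
    then show ?thesis using that unfolding H_def by (meson minimal_member_below)
  qed
  have "k \<noteq> 0"
  proof
    assume "k = 0"
    then have "{} \<in> H" using below[OF assms(4)] small assms(1) H F
      by (metis card_0_eq finite_subset less_one power_0 PowD subsetD)
    then show False using H assms(3) by blast
  qed
  then have "16 * p \<le> 16 * real k * p" using assms(5) by (simp add: mult_right_mono)
  then have q: "0 \<le> 16 * p" "16 * p \<le> 1" using assms(5) False by linarith+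
  define s where "s = 1 - (1 - 16 * p) ^ k"
  have s: "0 \<le> s" "s \<le> 1" using q by (auto simp: s_def power_le_one)
  have "covers U F" if "covers U H" for U
    using that below unfolding covers_def by (meson order_trans)
  then have cost: "1 / 2 \<le> cost p U" if "U \<subseteq> Pow X" "covers U H" for U
    using not_weakly_small_cost[OF assms(1) F assms(6)] that by (simp add: less_imp_le)
  have "expect X s (\<lambda>W. of_bool (\<not> (\<exists>S\<in>H. S \<subseteq> W))) = 1 - mu X s F"
  proof -
    have "W \<in> F" if "S \<in> H" "S \<subseteq> W" "W \<subseteq> X" for S W
      using that H assms(2) unfolding increasing_def by blast
    then have iff: "(\<exists>S\<in>H. S \<subseteq> W) \<longleftrightarrow> W \<in> F" if "W \<subseteq> X" for W
      using that below by blast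
    have "expect X s (\<lambda>W. of_bool (\<exists>S\<in>H. S \<subseteq> W)) = mu X s F"
      unfolding mu_eq_expect[OF assms(1) F] expect_def using iff by (intro sum.cong) auto
    then show ?thesis unfolding expect_of_bool_not[OF assms(1)] by simp
  qed
  moreover have "1 / 2 * expect X s (\<lambda>W. of_bool (\<not> (\<exists>S\<in>H. S \<subseteq> W))) \<le> (1 - (1 / 4) ^ k) / 6"
    unfolding s_def using assms(1,5) q cost H F small
    by (intro cover_cost_times_failure) auto
  moreover have "(1 - (1 / 4) ^ k) / 6 \<le> (1 / 6 :: real)" by simp
  ultimately have "1 / 2 \<le> mu X s F" by linarith
  then have "threshold X F \<le> s" using assms(1-4) s by (intro threshold_le) auto
  also have "s \<le> 16 * real k * p"
    using Bernoulli_inequality[of "- (16 * p)" k] q by (simp add: s_def algebra_simps)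
  finally show ?thesis .
qed

section \<open>The bound on the threshold\<close>

lemma dyadic_bound:
  obtains k where "l < 2 ^ k" "real k \<le> 2 / ln 2 * ln (max 2 (real l))"
proof (cases "l = 0")
  case True
  then show ?thesis using that[of 0] by simp
next
  case False
  then obtain j where j: "2 ^ j \<le> l" "l < 2 ^ (j + 1)"
    using ex_power_ivl1[of 2 l] by auto
  have "j * ln 2 = ln (2 ^ j :: real)" by (simp add: ln_realpow)
  also have "\<dots> \<le> ln (max 2 (real l))"
  proof -
    have "(2 :: real) ^ j \<le> real l" using j(1) by (metis of_nat_le_iff of_nat_numeral of_nat_power)
    also have "real l \<le> max 2 (real l)" by simp
    finally show ?thesis by (intro ln_mono) auto
  qed
  finally have "j * ln 2 \<le> ln (max 2 (real l))" .
  moreover have "ln 2 \<le> ln (max 2 (real l))" by (intro ln_mono) auto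
  ultimately have "real (j + 1) * ln 2 \<le> 2 * ln (max 2 (real l))" unfolding of_nat_add of_nat_1 distrib_right by linarith
  then have "real (j + 1) \<le> 2 / ln 2 * ln (max 2 (real l))" by (simp add: field_simps)
  then show ?thesis using that j(2) by blast
qed

theorem theorem1p1:
  "\<exists>K :: real. \<forall>(X :: nat set) F.
     finite X \<and> increasing X F \<and> F \<noteq> {} \<and> F \<noteq> Pow X \<longrightarrow>
       threshold X F \<le> K * fractional_expectation_threshold X F * ln (max 2 (real (ell F)))"
proof (intro exI[of _ "32 / ln 2"] allI impI, elim conjE)
  fix X :: "nat set" and F
  assume X: "finite X" "increasing X F" and ne: "F \<noteq> {}" "F \<noteq> Pow X"
  have F: "F \<subseteq> Pow X" using X(2) by (simp add: increasing_def)
  have top: "X \<in> F" using X(2) ne(1) F unfolding increasing_def by blast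
  have bot: "{} \<notin> F" using X(2) ne(2) F unfolding increasing_def by blast
  obtain m where m: "0 \<le> m" "m \<le> 1" "weakly_small X F m"
    and greatest: "\<And>p. 0 \<le> p \<Longrightarrow> p \<le> 1 \<Longrightarrow> weakly_small X F p \<Longrightarrow> p \<le> m"
    using greatest_weakly_small[OF X(1) F bot] by blast
  have qf: "fractional_expectation_threshold X F = m"
    unfolding fractional_expectation_threshold_def using m greatest
    by (intro Greatest_equality) auto
  have "m \<noteq> 1" using m(3) not_weakly_small_1[OF X(1) F top] by blast
  then have "m < 1" using m(2) by simp
  obtain k where k: "ell F < 2 ^ k" "real k \<le> 2 / ln 2 * ln (max 2 (real (ell F)))"
    by (rule dyadic_bound)
  have above: "threshold X F \<le> 16 * real k * p" if "m < p" "p \<le> 1" for p :: real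
    using that m(1) greatest[of p] k(1)
    by (intro threshold_le_of_not_weakly_small[OF X bot top]) auto
  \<comment> \<open>At \<open>m\<close> itself the family is weakly small, so the bound is reached only as a limit from above.\<close>
  have "threshold X F \<le> 16 * real k * m"
  proof (rule tendsto_lowerbound)
    show "((\<lambda>p. 16 * real k * p) \<longlongrightarrow> 16 * real k * m) (at_right m)"
      by (intro tendsto_intros)
    show "\<forall>\<^sub>F p in at_right m. threshold X F \<le> 16 * real k * p"
      using eventually_at_right_real[OF \<open>m < 1\<close>]
      by eventually_elim (rule above, auto)
  qed simp
  also have "\<dots> \<le> 16 * (2 / ln 2 * ln (max 2 (real (ell F)))) * m"
    using k(2) m(1) by (intro mult_right_mono mult_left_mono) auto
  finally show "threshold X F \<le> 32 / ln 2 * fractional_expectation_threshold X F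
      * ln (max 2 (real (ell F)))"
    unfolding qf by (simp add: algebra_simps)
qed

end
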